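(* Consider the delay initial value problem $y'(t)=f(t,y(t),y(t-\tau))$, $t\in[0,T]$, $y(t)=\phi(t)$ for $-\tau\le t\le 0$, where $f$ satisfies Lipschitz conditions with respect to its second and third arguments with constants $L_1$ and $L_2$, respectively. Let $(y_n)$ be the numerical solution at the nodes $t_n=nh$ produced by the improved implicit Euler method $$y_{n+1}=y_n+h\,f\bigl(t_{n+1},\;y_n+h f(t_{n+1},y_n,\nu_{n+1}),\;\nu_{n+1}\bigr)$$ with initial value $y_0=\phi(0)$, and let $(\tilde y_n)$ be the numerical solution produced by the same method with perturbed initial value $\tilde y_0=y_0+\epsilon_0$, $\epsilon_0>0$. Then there exist positive constants $k$ and $\epsilon_1$ (independent of $n$, $h$, $\epsilon_0$ and $\epsilon$) such that $$|y_n-\tilde y_n|\le k\,\epsilon\qquad\text{for all } n \text{ with } nh\le T \text{ and all step sizes } h\in(0,\epsilon_1),$$ whenever $|\epsilon_0|\le\epsilon$.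
   Context: Setting: $d\ge1$ is an integer, $\tau>0$, $T>0$, $|\cdot|$ is the Euclidean norm on $\mathbb{R}^d$, $\phi:[-\tau,0]\to\mathbb{R}^d$ is the history function, and $f:[0,T]\times\mathbb{R}^d\times\mathbb{R}^d\to\mathbb{R}^d$ is continuous, bounded and satisfies $$|f(t,x_1,u)-f(t,x_2,u)|\le L_1|x_1-x_2|,\qquad |f(t,x,u_1)-f(t,x,u_2)|\le L_2|u_1-u_2|$$ with positive constants $L_1,L_2$. The perturbation is $\epsilon_0\in\mathbb{R}^d$, and $\epsilon_0>0$ means that all components of $\epsilon_0$ are positive (for $d=1$ this is the usual meaning). Grid: the step sizes considered are those $h>0$ for which $m=\tau/h$ and $N=T/h$ are positive integers; $t_n=nh$, $0\le n\le N$. Delay approximation: for the unperturbed solution, $\nu_n=y_{n-m}$ if $n\ge m$ and $\nu_n=\phi(t_n-\tau)$ if $n<m$. For the perturbed solution the same recipe is used with its own values, i.e. $\nu_n$ is replaced by $\tilde\nu_n=\tilde y_{n-m}$ if $n\ge m$ and $\tilde\nu_n=\phi(t_n-\tau)$ if $n<m$ (the history function $\phi$ is not perturbed; only the initial value at $t=0$ is). *)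

theory Defs
  imports "HOL-Analysis.Analysis"
begin

definition grid_step :: "real \<Rightarrow> real \<Rightarrow> real \<Rightarrow> nat \<Rightarrow> nat \<Rightarrow> bool" where
  "grid_step \<tau> T h m N \<longleftrightarrow>
     0 < h \<and> 0 < m \<and> 0 < N \<and> real m = \<tau> / h \<and> real N = T / h"

text \<open>
  The approximation \<open>\<nu>\<^sub>n\<close> of the delayed value \<open>y (t\<^sub>n - \<tau>)\<close>. It is computed from the sequence \<open>y\<close> it is
  applied to, so a perturbed solution uses its own earlier values; the history \<open>\<phi>\<close> is shared, and
  is evaluated only on \<open>[-\<tau>, 0)\<close> here. For \<open>n = m\<close> the value is \<open>y 0\<close>, not \<open>\<phi> 0\<close>.
\<close>
definition delay_approx ::
    "(real \<Rightarrow> real ^ 'd) \<Rightarrow> real \<Rightarrow> real \<Rightarrow> nat \<Rightarrow> (nat \<Rightarrow> real ^ 'd) \<Rightarrow> nat \<Rightarrow> real ^ 'd" where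
  "delay_approx \<phi> \<tau> h m y n = (if m \<le> n then y (n - m) else \<phi> (real n * h - \<tau>))"

text \<open>
  Only the entries \<open>y 0, \<dots>, y N\<close> are constrained. As \<open>m > 0\<close> on the grid, \<open>\<nu>\<^bsub>n+1\<^esub>\<close> involves no
  entry beyond \<open>y n\<close>, so the recursion is explicit and determines them uniquely.
\<close>
definition improved_implicit_euler ::
    "(real \<Rightarrow> real ^ 'd \<Rightarrow> real ^ 'd \<Rightarrow> real ^ 'd) \<Rightarrow> (real \<Rightarrow> real ^ 'd) \<Rightarrow>
     real \<Rightarrow> real \<Rightarrow> nat \<Rightarrow> nat \<Rightarrow> real ^ 'd \<Rightarrow> (nat \<Rightarrow> real ^ 'd) \<Rightarrow> bool" where
  "improved_implicit_euler f \<phi> \<tau> h m N a y \<longleftrightarrow>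
     y 0 = a \<and>
     (\<forall>n<N. let t = real (n + 1) * h; \<nu> = delay_approx \<phi> \<tau> h m y (n + 1)
            in y (n + 1) = y n + h *\<^sub>R f t (y n + h *\<^sub>R f t (y n) \<nu>) \<nu>)"

end

theory Submission
  imports Defs
begin

text \<open>
  For \<open>h < 1\<close> one step of the method multiplies the running maximum of the error by at most
  \<open>1 + h C\<close>, where \<open>C = L1 (1 + L1 + L2) + L2\<close>; the delayed values cost nothing extra because they
  are either shared history or earlier iterates. Over at most \<open>T / h\<close> steps this accumulates to at
  most \<open>exp (C T)\<close>.
\<close>

text \<open>A common bound \<open>P\<close> on the current and the delayed error lets both Lipschitz
  conditions be charged to one number. The inner Euler stage enlarges \<open>P\<close> by at most
  \<open>1 + L1 + L2\<close>, where \<open>h \<le> 1\<close> absorbs the step size. The outer factor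
  \<open>h\<close> has to be kept: it is what makes the growth over \<open>T / h\<close> steps
  bounded.\<close>

lemma improved_euler_step_diff_le:
  fixes g :: "'a::real_normed_vector \<Rightarrow> 'b::real_normed_vector \<Rightarrow> 'a"
  assumes "0 \<le> L1" and "0 \<le> L2" and "0 \<le> h" and "h \<le> 1"
    and lip1: "\<And>x1 x2 u. norm (g x1 u - g x2 u) \<le> L1 * norm (x1 - x2)"
    and lip2: "\<And>x u1 u2. norm (g x u1 - g x u2) \<le> L2 * norm (u1 - u2)"
    and x: "norm (x - x') \<le> P" and u: "norm (u - u') \<le> P"
  shows "norm ((x + h *\<^sub>R g (x + h *\<^sub>R g x u) u) - (x' + h *\<^sub>R g (x' + h *\<^sub>R g x' u') u'))
    \<le> (1 + h * (L1 * (1 + L1 + L2) + L2)) * P"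
proof -
  have "0 \<le> P"
    using x norm_ge_zero by (rule order_trans[rotated])
  \<comment> \<open>The delayed arguments stay fixed while \<open>a\<close> and \<open>b\<close>
    vary, so that this serves the inner slopes (at \<open>x\<close>, \<open>x'\<close>) as well as
    the outer ones (at \<open>z\<close>, \<open>z'\<close>). The fact \<open>step\<close> is general
    in \<open>v\<close>, \<open>v'\<close> for the same reason.\<close>
  have lip: "norm (g a u - g b u') \<le> L1 * norm (a - b) + L2 * P" for a b
  proof -
    have "norm (g a u - g b u') \<le> norm (g a u - g b u) + norm (g b u - g b u')"
      using norm_triangle_ineq[of "g a u - g b u" "g b u - g b u'"] by simp
    also have "\<dots> \<le> L1 * norm (a - b) + L2 * P"
      using lip1[of a u b] lip2[of b u u'] mult_left_mono[OF u \<open>0 \<le> L2\<close>] by linarith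
    finally show ?thesis .
  qed
  have step: "norm ((x + h *\<^sub>R v) - (x' + h *\<^sub>R v')) \<le> P + h * norm (v - v')" for v v'
  proof -
    have "(x + h *\<^sub>R v) - (x' + h *\<^sub>R v') = (x - x') + h *\<^sub>R (v - v')"
      by (simp add: algebra_simps)
    then have "norm ((x + h *\<^sub>R v) - (x' + h *\<^sub>R v')) \<le> norm (x - x') + norm (h *\<^sub>R (v - v'))"
      by (simp only: norm_triangle_ineq)
    also have "\<dots> \<le> P + h * norm (v - v')"
      using x \<open>0 \<le> h\<close> by simp
    finally show ?thesis .
  qed
  define z z' where "z = x + h *\<^sub>R g x u" and "z' = x' + h *\<^sub>R g x' u'"
  have g0: "norm (g x u - g x' u') \<le> (L1 + L2) * P"
    using lip[of x x'] mult_left_mono[OF x \<open>0 \<le> L1\<close>] by (simp add: algebra_simps)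
  have "norm (z - z') \<le> P + h * norm (g x u - g x' u')"
    unfolding z_def z'_def by (rule step)
  also have "\<dots> \<le> P + 1 * ((L1 + L2) * P)"
    using g0 assms(1-4) by (intro add_mono mult_mono) auto
  finally have z: "norm (z - z') \<le> (1 + L1 + L2) * P"
    by (simp add: algebra_simps)
  have "norm (g z u - g z' u') \<le> L1 * norm (z - z') + L2 * P"
    by (rule lip)
  also have "\<dots> \<le> L1 * ((1 + L1 + L2) * P) + L2 * P"
    using z assms(1,2) by (intro add_mono mult_left_mono) auto
  finally have "h * norm (g z u - g z' u') \<le> h * (L1 * ((1 + L1 + L2) * P) + L2 * P)"
    using \<open>0 \<le> h\<close> by (rule mult_left_mono)
  then have "norm ((x + h *\<^sub>R g z u) - (x' + h *\<^sub>R g z' u'))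
      \<le> P + h * (L1 * ((1 + L1 + L2) * P) + L2 * P)"
    using step[of "g z u" "g z' u'"] by linarith
  then show ?thesis
    unfolding z_def z'_def by (simp add: algebra_simps)
qed

text \<open>Strong induction is needed because the delayed value reaches back \<open>m\<close>
  steps. The growth factor is at least 1, so the bound at index \<open>j\<close> also covers all
  earlier indices.\<close>

lemma improved_implicit_euler_diff_le:
  fixes f :: "real \<Rightarrow> real ^ 'd \<Rightarrow> real ^ 'd \<Rightarrow> real ^ 'd"
  assumes "0 \<le> L1" and "0 \<le> L2"
    and lip1: "\<And>t x1 x2 u. t \<in> {0..T} \<Longrightarrow> norm (f t x1 u - f t x2 u) \<le> L1 * norm (x1 - x2)"
    and lip2: "\<And>t x u1 u2. t \<in> {0..T} \<Longrightarrow> norm (f t x u1 - f t x u2) \<le> L2 * norm (u1 - u2)"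
    and grid: "grid_step \<tau> T h m N" and "h \<le> 1"
    and y: "improved_implicit_euler f \<phi> \<tau> h m N a y"
    and y': "improved_implicit_euler f \<phi> \<tau> h m N b y'"
    and "n \<le> N"
  shows "norm (y n - y' n) \<le> (1 + h * (L1 * (1 + L1 + L2) + L2)) ^ n * norm (a - b)"
  using \<open>n \<le> N\<close>
proof (induction n rule: less_induct)
  case (less n)
  define C where "C = L1 * (1 + L1 + L2) + L2"
  have "0 < h" "0 < m" and NT: "real N * h = T"
    using grid by (auto simp: grid_step_def)
  have q: "1 \<le> 1 + h * C"
    using assms(1,2) \<open>0 < h\<close> by (simp add: C_def)
  show ?case
  proof (cases n)
    case 0
    then show ?thesis
      using y y' by (simp add: improved_implicit_euler_def)
  next
    case (Suc j)
    then have "j < N" using less.prems by simp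
    define P where "P = (1 + h * C) ^ j * norm (a - b)"
    have prev: "norm (y i - y' i) \<le> P" if "i \<le> j" for i
    proof -
      have "norm (y i - y' i) \<le> (1 + h * C) ^ i * norm (a - b)"
        using less.IH[of i] less.prems that Suc by (simp add: C_def)
      also have "\<dots> \<le> P"
        unfolding P_def by (intro mult_right_mono power_increasing that q norm_ge_zero)
      finally show ?thesis .
    qed
    define t where "t = real (j + 1) * h"
    \<comment> \<open>The Lipschitz conditions hold only for times in \<open>{0..T}\<close>; the
      step evaluates \<open>f\<close> at the new node, which lies there since
      \<open>j + 1 \<le> N\<close>.\<close>
    have "t \<le> real N * h"
      unfolding t_def using \<open>j < N\<close> \<open>0 < h\<close> by (intro mult_right_mono) auto
    then have t: "t \<in> {0..T}"
      using NT \<open>0 < h\<close> by (simp add: t_def)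
    define \<nu> \<nu>' where "\<nu> = delay_approx \<phi> \<tau> h m y (j + 1)"
      and "\<nu>' = delay_approx \<phi> \<tau> h m y' (j + 1)"
    have "0 \<le> P"
      using prev[of j] norm_ge_zero[of "y j - y' j"] by linarith
    \<comment> \<open>If \<open>j + 1 < m\<close>, both values are the same history value and the
      difference is 0. Otherwise they are iterates of index \<open>j + 1 - m\<close>, which is at
      most \<open>j\<close> because \<open>m > 0\<close>.\<close>
    then have \<nu>: "norm (\<nu> - \<nu>') \<le> P"
      using prev[of "Suc j - m"] \<open>0 < m\<close> by (auto simp: \<nu>_def \<nu>'_def delay_approx_def)
    have "y n = y j + h *\<^sub>R f t (y j + h *\<^sub>R f t (y j) \<nu>) \<nu>"
      and "y' n = y' j + h *\<^sub>R f t (y' j + h *\<^sub>R f t (y' j) \<nu>') \<nu>'"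
      using y y' \<open>j < N\<close> Suc
      by (simp_all add: improved_implicit_euler_def Let_def t_def \<nu>_def \<nu>'_def)
    moreover have "norm ((y j + h *\<^sub>R f t (y j + h *\<^sub>R f t (y j) \<nu>) \<nu>)
        - (y' j + h *\<^sub>R f t (y' j + h *\<^sub>R f t (y' j) \<nu>') \<nu>')) \<le> (1 + h * C) * P"
      unfolding C_def using \<open>0 < h\<close> assms(1,2,6) prev[of j] \<nu>
      by (intro improved_euler_step_diff_le lip1[OF t] lip2[OF t]) auto
    ultimately show ?thesis
      by (simp add: P_def C_def Suc mult.assoc)
  qed
qed

theorem theorem5p1:
  fixes f :: "real \<Rightarrow> real ^ 'd \<Rightarrow> real ^ 'd \<Rightarrow> real ^ 'd"
    and \<phi> :: "real \<Rightarrow> real ^ 'd"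
    and \<tau> T L1 L2 :: real
  assumes "0 < \<tau>" and "0 < T" and "0 < L1" and "0 < L2"
    and "continuous_on ({0..T} \<times> UNIV \<times> UNIV) (\<lambda>(t, x, u). f t x u)"
    and "bounded ((\<lambda>(t, x, u). f t x u) ` ({0..T} \<times> UNIV \<times> UNIV))"
    and "\<And>t x1 x2 u. t \<in> {0..T} \<Longrightarrow> norm (f t x1 u - f t x2 u) \<le> L1 * norm (x1 - x2)"
    and "\<And>t x u1 u2. t \<in> {0..T} \<Longrightarrow> norm (f t x u1 - f t x u2) \<le> L2 * norm (u1 - u2)"
  shows "\<exists>k \<epsilon>1 :: real. 0 < k \<and> 0 < \<epsilon>1 \<and>
    (\<forall>(\<epsilon>0 :: real ^ 'd) (\<epsilon> :: real) (h :: real) (m :: nat) (N :: nat)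
       (y :: nat \<Rightarrow> real ^ 'd) (y' :: nat \<Rightarrow> real ^ 'd).
       (\<forall>i. 0 < \<epsilon>0 $ i) \<longrightarrow> norm \<epsilon>0 \<le> \<epsilon> \<longrightarrow>
       h \<in> {0<..<\<epsilon>1} \<longrightarrow> grid_step \<tau> T h m N \<longrightarrow>
       improved_implicit_euler f \<phi> \<tau> h m N (\<phi> 0) y \<longrightarrow>
       improved_implicit_euler f \<phi> \<tau> h m N (y 0 + \<epsilon>0) y' \<longrightarrow>
       (\<forall>n :: nat. real n * h \<le> T \<longrightarrow> norm (y n - y' n) \<le> k * \<epsilon>))"
proof -
  define C where "C = L1 * (1 + L1 + L2) + L2"
  have "0 < C"
    using assms(3,4) by (simp add: C_def add_pos_pos)
  \<comment> \<open>The witness for \<open>k\<close> is the limit of the growth factors, from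
    \<open>1 + h * C \<le> exp (h * C)\<close> and \<open>n * h \<le> T\<close>; the threshold 1 for
    \<open>h\<close> is what the one-step estimate requires.\<close>
  show ?thesis
  proof (rule exI[of _ "exp (C * T)"], rule exI[of _ 1], intro conjI allI impI)
    fix \<epsilon>0 :: "real ^ 'd" and \<epsilon> h :: real and m N :: nat and y y' :: "nat \<Rightarrow> real ^ 'd" and n :: nat
    assume \<epsilon>: "norm \<epsilon>0 \<le> \<epsilon>" and h: "h \<in> {0<..<1}" and grid: "grid_step \<tau> T h m N"
      and y: "improved_implicit_euler f \<phi> \<tau> h m N (\<phi> 0) y"
      and y': "improved_implicit_euler f \<phi> \<tau> h m N (y 0 + \<epsilon>0) y'"
      and n: "real n * h \<le> T"
    have "0 < h" using h by simp
    have "real N * h = T"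
      using grid by (simp add: grid_step_def)
    \<comment> \<open>The recursion says nothing about entries beyond \<open>N\<close>, so
      \<open>n * h \<le> T\<close> must be turned into a bound on the index.\<close>
    then have "n \<le> N"
      using n \<open>0 < h\<close> by (metis mult_le_cancel_right_pos of_nat_le_iff)
    have "y 0 = \<phi> 0"
      using y by (simp add: improved_implicit_euler_def)
    then have "norm (y n - y' n) \<le> (1 + h * C) ^ n * norm \<epsilon>0"
      using improved_implicit_euler_diff_le[OF _ _ assms(7,8) grid _ y y' \<open>n \<le> N\<close>] assms(3,4) h
      by (simp add: C_def)
    also have "\<dots> \<le> exp (h * C) ^ n * norm \<epsilon>0"
      using \<open>0 < h\<close> \<open>0 < C\<close> by (intro mult_right_mono power_mono exp_ge_add_one_self) auto
    also have "exp (h * C) ^ n = exp (C * (real n * h))"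
      by (simp add: exp_of_nat_mult[symmetric] mult_ac)
    also have "exp (C * (real n * h)) * norm \<epsilon>0 \<le> exp (C * T) * \<epsilon>"
      using n \<epsilon> \<open>0 < C\<close> by (intro mult_mono) auto
    finally show "norm (y n - y' n) \<le> exp (C * T) * \<epsilon>" .
  qed auto
qed

end
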